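(* Let $\ell\ge3$ and let $t$ be a positive integer with $t<f_\ell(1)$. Then for every message $\mathbf{x}\in\{0,1\}^{k_\ell-2t}$, the output $\mathbf{c}$ of the encoding algorithm EncodeB on $\mathbf{x}$ is correctly decoded by the algorithm DecodeB, i.e. DecodeB on input $\mathbf{c}$ outputs $\mathbf{x}$.
   Context: The sequence $f_\ell$: if $\ell$ is not a power of $2$, put $\mu = 2^{\lceil \log_2 \ell\rceil} - \ell$ and $f_\ell(i) = \ell - \lceil \log_2\ell\rceil$ for $1\le i\le \ell-\mu$; $f_\ell(i) = \ell - \lfloor \log_2\ell\rfloor$ for $\ell-\mu+1\le i\le \ell-1$; $f_\ell(\ell)=\ell$. If $\ell$ is a power of $2$, put $f_\ell(1) = \ell-\log_2\ell-1$; $f_\ell(i)=\ell-\log_2\ell$ for $2\le i\le \ell-1$; $f_\ell(\ell)=\ell$. Put $k_\ell=\sum_{i=1}^\ell f_\ell(i)$ and $n=2^\ell-2^t+1$. For a binary vector $\mathbf{y}$, $\mathrm{dec}(\mathbf{y})$ is its decimal value, most significant bit first. For a vector $\mathbf{g}=(g[0],\dots,g[\ell-1])$ and $n_0\in\{0,\dots,\ell-1\}$, $\mathrm{cshift}(\mathbf{g},n_0)=(g[n_0],\dots,g[\ell-1],g[0],\dots,g[n_0-1])$. EncodeB (input $\mathbf{x}\in\{0,1\}^{k_\ell-2t}$; output a binary vector of length $n$): write $\mathbf{x}=\mathbf{x}_\ell\Vert\mathbf{x}_{\ell-1}\Vert\cdots\Vert\mathbf{x}_1$ (concatenation) with $|\mathbf{x}_\ell|=\ell-t$,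 $|\mathbf{x}_i|=f_\ell(i)$ for $2\le i\le\ell-1$, and $|\mathbf{x}_1|=f_\ell(1)-t$. Start with $\mathbf{c}=0^{2^\ell}$ (coordinates indexed $0,\dots,2^\ell-1$), set $\mathrm{pos}=2^t\,\mathrm{dec}(\mathbf{x}_\ell)$ and $c[\mathrm{pos}]=1$. For $j=\ell-1,\dots,1$ in this order, replace $\mathrm{pos}$ by $(\mathrm{pos}+1+\mathrm{dec}(\mathbf{x}_j))\bmod 2^\ell$ and set $c[\mathrm{pos}]=1$. Finally delete from $\mathbf{c}$ the $2^t-1$ coordinates with indices $(\mathrm{pos}+1)\bmod 2^\ell,\dots,(\mathrm{pos}+2^t-1)\bmod 2^\ell$, where $\mathrm{pos}$ is the final value, keeping the remaining coordinates in their original order and reindexing them $0,\dots,n-1$; the result is the output. Every output has exactly $\ell$ ones. DecodeB (input an output $\mathbf{c}$ of EncodeB): let $0\le j[0]<\cdots<j[\ell-1]<n$ be the positions of the ones of $\mathbf{c}$, and $\mathbf{g}[m]=(j[m]-j[(m-1)\bmod\ell]-1)\bmod n$ for $0\le m\le\ell-1$. Let $\boldsymbol\gamma_B$ be the vector of length $\ell$ with first entry $2^\ell-1-\sum_{i=1}^{\ell-1}2^{f_\ell(i)}+(1-2^{-t})2^{f_\ell(1)}$, followed by $2^{f_\ell(i)}-1$ for $i=\ell-1,\dots,2$, followed by $2^{f_\ell(1)-t}-1$. If $\mathrm{cshift}(\mathbf{g},n_0)=\boldsymbol\gamma_B$ for some $n_0\in\{0,\dots,\ell-1\}$, set $A=n_0$;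 otherwise set $A=\arg\max_{0\le m\le\ell-1}\mathbf{g}[m]$. Output the binary representation of $\lceil j[A]/2^t\rceil$ of length $\ell-t$ followed, for $i=1,\dots,\ell-1$ in this order, by the binary representation of $\mathbf{g}[(A+i)\bmod\ell]$, of length $f_\ell(\ell-i)$ for $i\le\ell-2$ and of length $f_\ell(1)-t$ for $i=\ell-1$. *)

theory Defs
  imports Complex_Main "HOL-Library.Log_Nat"
begin

definition f_seq :: "nat \<Rightarrow> nat \<Rightarrow> nat" where
  "f_seq l i =
    (if i = l then l
     else if \<exists>k. l = 2 ^ k then
       (if i = 1 then l - nat \<lfloor>log 2 (real l)\<rfloor> - 1 else l - nat \<lfloor>log 2 (real l)\<rfloor>)
     else let mu = 2 ^ ceillog2 l - l in
       (if i \<le> l - mu then l - ceillog2 l else l - nat \<lfloor>log 2 (real l)\<rfloor>))"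

definition k_sum :: "nat \<Rightarrow> nat" where
  "k_sum l = (\<Sum>i = 1..l. f_seq l i)"

definition code_len :: "nat \<Rightarrow> nat \<Rightarrow> nat" where
  "code_len l t = 2 ^ l - 2 ^ t + 1"

(* horner_sum takes the least significant bit first, dec the most significant one *)
definition dec :: "bool list \<Rightarrow> nat" where
  "dec y = horner_sum of_bool 2 (rev y)"

(* unspecified, rather than truncated, if v does not fit into m bits *)
definition bin_rep :: "nat \<Rightarrow> nat \<Rightarrow> bool list" where
  "bin_rep m v = (THE y. length y = m \<and> dec y = v)"

definition block_len :: "nat \<Rightarrow> nat \<Rightarrow> nat \<Rightarrow> nat" where
  "block_len l t i =
    (if i = l then l - t else if i = 1 then f_seq l 1 - t else f_seq l i)"

(* The block x_i of the message x = x_l x_(l-1) ... x_1. *)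
definition block :: "nat \<Rightarrow> nat \<Rightarrow> bool list \<Rightarrow> nat \<Rightarrow> bool list" where
  "block l t x i = take (block_len l t i) (drop (\<Sum>k\<in>{i<..l}. block_len l t k) x)"

definition encode_step ::
    "nat \<Rightarrow> nat \<Rightarrow> bool list \<Rightarrow> nat \<Rightarrow> bool list \<times> nat \<Rightarrow> bool list \<times> nat" where
  "encode_step l t x j = (\<lambda>(c, pos).
     let pos' = (pos + 1 + dec (block l t x j)) mod 2 ^ l in (c[pos' := True], pos'))"

definition EncodeB :: "nat \<Rightarrow> nat \<Rightarrow> bool list \<Rightarrow> bool list" where
  "EncodeB l t x =
    (let pos0 = 2 ^ t * dec (block l t x l);
         (c, pos) = fold (encode_step l t x) (rev [1..<l])
                      ((replicate (2 ^ l) False)[pos0 := True], pos0)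
     in nths c (- {(pos + d) mod 2 ^ l | d. 1 \<le> d \<and> d \<le> 2 ^ t - 1}))"

definition ones :: "bool list \<Rightarrow> nat list" where
  "ones c = filter (\<lambda>i. c ! i) [0..<length c]"

definition gaps :: "nat \<Rightarrow> nat \<Rightarrow> bool list \<Rightarrow> int list" where
  "gaps l t c = map (\<lambda>m.
     (int (ones c ! m) - int (ones c ! nat ((int m - 1) mod int l)) - 1) mod int (code_len l t))
     [0..<l]"

(* The term (1 - 2^(-t)) 2^(f_l(1)) of the first entry is written as an integer;
   this needs t \<le> f_l(1). *)
definition gamma_B :: "nat \<Rightarrow> nat \<Rightarrow> int list" where
  "gamma_B l t =
    [2 ^ l - 1 - (\<Sum>i = 1..l - 1. 2 ^ f_seq l i) + (2 ^ f_seq l 1 - 2 ^ (f_seq l 1 - t))]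
    @ map (\<lambda>i. 2 ^ f_seq l i - 1) (rev [2..<l])
    @ [2 ^ (f_seq l 1 - t) - 1]"

(* The list function rotate n0 is the cyclic shift that moves entry n0 to the front.
   A choice among several admissible n0 or several maximisers is arbitrary. *)
definition anchor :: "nat \<Rightarrow> nat \<Rightarrow> int list \<Rightarrow> nat" where
  "anchor l t g =
    (if \<exists>n0<l. rotate n0 g = gamma_B l t
     then SOME n0. n0 < l \<and> rotate n0 g = gamma_B l t
     else ARG_MAX (\<lambda>m. g ! m) m. m < l)"

definition DecodeB :: "nat \<Rightarrow> nat \<Rightarrow> bool list \<Rightarrow> bool list" where
  "DecodeB l t c =
    (let g = gaps l t c; A = anchor l t g
     in bin_rep (l - t) (nat \<lceil>real (ones c ! A) / 2 ^ t\<rceil>)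
        @ concat (map (\<lambda>i. bin_rep (if i \<le> l - 2 then f_seq l (l - i) else f_seq l 1 - t)
                                   (nat (g ! ((A + i) mod l)))) [1..<l]))"

end

theory Submission
  imports Defs
begin

text \<open>
  Unroll the cyclic positions visited by the encoder, starting at the first one: they are
  \<open>start + S i\<close> with \<open>S\<close> increasing. Since the powers \<open>2 ^ f_seq l i\<close>, \<open>1 \<le> i < l\<close>, leave a surplus
  of at least \<open>2 * 2 ^ f_seq l 1\<close> below \<open>2 ^ l\<close>, the walk together with the deleted stretch behind
  it never laps the start, and the gap closing the cycle is strictly larger than
  every other gap. Hence the sorted list of ones is a rotation of the visiting order, and the
  maximal gap locates the start. Deletion moves the start, a multiple of \<open>2 ^ t\<close>,
  down by less than \<open>2 ^ t\<close>, which the ceiling undoes.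
\<close>

section \<open>The exponents \<open>f_seq\<close> and their surplus below
  \<open>2 ^ l\<close>\<close>

lemma f_seq_power_of_two:
  assumes "l = 2 ^ k"
  shows "f_seq l i = (if i = l then l else if i = 1 then l - k - 1 else l - k)"
proof -
  have "nat \<lfloor>log 2 (real l)\<rfloor> = k" using assms by simp
  then show ?thesis using assms by (auto simp: f_seq_def)
qed

text \<open>Here \<open>c\<close> is \<open>ceillog2 l\<close>. As \<open>l\<close> is not a power
  of two, the rounded-down logarithm is \<open>c - 1\<close>, and the threshold
  \<open>l - mu\<close> becomes \<open>2 * l - 2 ^ c\<close>. The bound \<open>c < l\<close> keeps
  the truncated subtractions exact.\<close>

lemma f_seq_not_power_of_two:
  assumes "\<nexists>k. l = 2 ^ k" "l \<ge> 3"
  obtains c where "2 ^ (c - 1) < l" "l < 2 ^ c" "c < l"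
    "\<And>i. i < l \<Longrightarrow> f_seq l i = (if i \<le> 2 * l - 2 ^ c then l - c else l - c + 1)"
proof -
  define c where "c = ceillog2 l"
  have u: "l < 2 ^ c"
    using le_two_power_ceillog2[of l] assms(1) unfolding c_def by (metis le_neq_implies_less)
  have d: "2 ^ c < 2 * l" using two_power_ceillog2_gt[of l] assms(2) by (simp add: c_def)
  have c0: "c > 0" using u assms(2) by (cases c) auto
  have d': "2 ^ (c - 1) < l" using d c0 by (cases c) auto
  have cl: "c < l"
  proof -
    have "l < 2 ^ (l - 1)"
    proof -
      \<comment> \<open>With \<open>m = l - 3\<close> this is the goal; the case
        \<open>l = 3\<close> is checked separately.\<close>
      have "m + 3 < 2 ^ (m + 2)" if "m \<ge> 1" for m :: nat
        using that by (induction m rule: dec_induct) auto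
      from this[of "l - 3"] show ?thesis
        using assms by (cases "l = 3") (auto simp: numeral_eq_Suc Suc_diff_Suc)
    qed
    then have "c \<le> l - 1" using assms(2) by (simp add: c_def ceillog2_le_iff)
    then show ?thesis using assms(2) by simp
  qed
  have fl: "\<lfloor>log 2 (real l)\<rfloor> = int (c - 1)"
    using floor_log_nat_eq_if[of 2 "c - 1" l] d' u c0 by simp
  have "f_seq l i = (if i \<le> 2 * l - 2 ^ c then l - c else l - c + 1)" if "i < l" for i
  proof -
    have "l - (2 ^ c - l) = 2 * l - 2 ^ c" using u by simp
    then show ?thesis
      using that assms(1) fl c0 cl by (auto simp: f_seq_def Let_def c_def[symmetric])
  qed
  with d' u cl show ?thesis by (rule that)
qed

text \<open>Below \<open>l\<close> at most two neighbouring exponents occur, and the smaller sits at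
  index 1.\<close>

lemma f_seq_le_Suc:
  assumes "l \<ge> 3" "1 \<le> i" "i < l"
  shows "f_seq l i \<le> f_seq l 1 + 1"
proof (cases "\<exists>k. l = 2 ^ k")
  case True
  then obtain k where "l = 2 ^ k" ..
  from f_seq_power_of_two[OF this] show ?thesis using assms by auto
next
  case False
  then obtain c where f: "\<And>i. i < l \<Longrightarrow> f_seq l i = (if i \<le> 2 * l - 2 ^ c then l - c else l - c + 1)"
    using f_seq_not_power_of_two assms(1) by metis
  have "l - c \<le> f_seq l 1" using f[of 1] assms by simp
  then show ?thesis using f[of i] assms by simp
qed

text \<open>Count the occurrences of the two exponents. If \<open>l\<close> is not a power of two,
  equality holds; if it is, a further \<open>2 ^ f_seq l 1\<close> is left over.\<close>

lemma sum_power_f_seq_le: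
  assumes "l \<ge> 3" "f_seq l 1 > 0"
  shows "(\<Sum>i = 1..<l. 2 ^ f_seq l i) + 2 * 2 ^ f_seq l 1 \<le> (2::nat) ^ l"
proof (cases "\<exists>k. l = 2 ^ k")
  case True
  then obtain k where k: "l = 2 ^ k" ..
  note f = f_seq_power_of_two[OF k]
  define F where "F = f_seq l 1"
  \<comment> \<open>Positivity of \<open>f_seq l 1\<close> ensures that \<open>l - k - 1\<close> is
    not truncated.\<close>
  have F: "F = l - k - 1" "l - k = Suc F" using f[of 1] assms by (auto simp: F_def)
  have "(\<Sum>i = 1..<l. 2 ^ f_seq l i) = (2 ^ f_seq l 1 + (\<Sum>i = 2..<l. 2 ^ f_seq l i) :: nat)"
    using assms by (subst sum.atLeast_Suc_lessThan) (auto simp: numeral_2_eq_2)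
  also have "(\<Sum>i = 2..<l. 2 ^ f_seq l i) = (\<Sum>i = 2..<l. 2 ^ Suc F :: nat)"
    by (rule sum.cong) (auto simp: f F(2))
  also have "\<dots> = (l - 2) * 2 ^ Suc F" by simp
  finally have "(\<Sum>i = 1..<l. 2 ^ f_seq l i) + 2 * 2 ^ f_seq l 1
      = 2 ^ F + (l - 2) * 2 ^ Suc F + 2 * (2 ^ F :: nat)" by (simp add: F_def)
  also have "\<dots> \<le> (l - 2) * 2 ^ Suc F + 2 * 2 ^ Suc F" by simp
  also have "\<dots> = l * 2 ^ Suc F"
    using assms(1) by (metis add_mult_distrib le_add_diff_inverse2 numeral_2_eq_2 numeral_3_eq_3 Suc_leD)
  also have "\<dots> = 2 ^ l"
    using F k assms(2) by (metis F_def add.commute diff_is_0_eq le_add_diff_inverse nat_le_linear old.nat.distinct(2) power_add)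
  finally show ?thesis .
next
  case False
  then obtain c where c: "2 ^ (c - 1) < l" "l < 2 ^ c" "c < l"
    and f: "\<And>i. i < l \<Longrightarrow> f_seq l i = (if i \<le> 2 * l - 2 ^ c then l - c else l - c + 1)"
    using f_seq_not_power_of_two assms(1) by metis
  define a where "a = 2 * l - 2 ^ c"
  have c0: "c > 0" using c assms(1) by (cases c) auto
  have a: "1 \<le> a" "a < l" "a + 2 ^ c = 2 * l" using c c0 unfolding a_def by (cases c; auto)+
  have f1: "f_seq l 1 = l - c" using f[of 1] a assms(1) by (simp add: a_def)
  have "(\<Sum>i = 1..<l. 2 ^ f_seq l i)
      = (\<Sum>i = 1..<Suc a. 2 ^ f_seq l i) + (\<Sum>i = Suc a..<l. 2 ^ f_seq l i :: nat)"
    using a by (intro sum.atLeastLessThan_concat[symmetric]) auto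
  also have "(\<Sum>i = 1..<Suc a. 2 ^ f_seq l i) = (\<Sum>i = 1..<Suc a. 2 ^ (l - c) :: nat)"
    using a by (intro sum.cong) (auto simp: f a_def)
  also have "(\<Sum>i = Suc a..<l. 2 ^ f_seq l i) = (\<Sum>i = Suc a..<l. 2 ^ (l - c + 1) :: nat)"
    using a by (intro sum.cong) (auto simp: f a_def)
  finally have "(\<Sum>i = 1..<l. 2 ^ f_seq l i) + 2 * 2 ^ f_seq l 1
      = (a + 2 * (l - Suc a) + 2) * (2 ^ (l - c) :: nat)"
    unfolding f1 by (simp add: add_mult_distrib)
  also have "a + 2 * (l - Suc a) + 2 = 2 ^ c" using a by simp
  also have "2 ^ c * 2 ^ (l - c) = (2 :: nat) ^ l" using c by (simp flip: power_add)
  finally show ?thesis by simp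
qed

section \<open>Binary representations of fixed length\<close>

lemma dec_less: "dec y < 2 ^ length y"
  using horner_sum_of_bool_2_less[of "rev y"] by (simp add: dec_def)

text \<open>After reversal the head is the least significant bit, which parity determines. This is
  the uniqueness behind the \<open>THE\<close> in \<open>bin_rep\<close>.\<close>

lemma dec_inject:
  assumes "length y = length z" "dec y = dec z"
  shows "y = z"
proof -
  have "xs = ys" if "length xs = length ys"
      "horner_sum of_bool 2 xs = (horner_sum of_bool 2 ys :: nat)" for xs ys
    using that
  proof (induction xs ys rule: list_induct2)
    case (Cons x xs y ys)
    then have e: "of_bool x + 2 * horner_sum of_bool 2 xs
        = (of_bool y + 2 * horner_sum of_bool 2 ys :: nat)" by simp
    then have "x = y" by (cases x; cases y; simp) presburger+
    with e Cons.IH show ?case by simp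
  qed simp
  from this[of "rev y" "rev z"] show ?thesis using assms by (simp add: dec_def)
qed

lemma bin_rep_dec: "length y = m \<Longrightarrow> bin_rep m (dec y) = y"
  unfolding bin_rep_def by (rule the_equality) (auto intro: dec_inject)

section \<open>Reindexing of coordinates under deletion\<close>

text \<open>For \<open>p \<in> I\<close> this is the new index of coordinate \<open>p\<close> once
  only the coordinates in \<open>I\<close> are kept.\<close>

definition rank :: "nat set \<Rightarrow> nat \<Rightarrow> nat" where
  "rank I p = card {q. q < p \<and> q \<in> I}"

lemma rank_0 [simp]: "rank I 0 = 0"
  by (simp add: rank_def)

lemma rank_Suc: "rank I (Suc p) = rank I p + of_bool (p \<in> I)"
proof -
  have "{q. q < Suc p \<and> q \<in> I} = (if p \<in> I then insert p {q. q < p \<and> q \<in> I} else {q. q < p \<and> q \<in> I})"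
    by (auto simp: less_Suc_eq)
  then show ?thesis by (simp add: rank_def)
qed

lemma rank_mono: "p \<le> q \<Longrightarrow> rank I p \<le> rank I q"
  unfolding rank_def by (rule card_mono) auto

lemma rank_less: "p \<in> I \<Longrightarrow> p < q \<Longrightarrow> rank I p < rank I q"
  using rank_mono[of "Suc p" q I] by (simp add: rank_Suc)

lemma length_nths_rank: "length (nths c I) = rank I (length c)"
  by (simp add: length_nths rank_def)

lemma set_ones: "set (ones c) = {i. i < length c \<and> c ! i}"
  by (auto simp: ones_def)

lemma set_ones_nths:
  "set (ones (nths c I)) = rank I ` {p. p < length c \<and> p \<in> I \<and> c ! p}"
proof (induction c rule: rev_induct)
  case (snoc b c)
  have "{i. i < length (nths (c @ [b]) I) \<and> nths (c @ [b]) I ! i}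
      = {i. i < length (nths c I) \<and> nths c I ! i}
        \<union> (if length c \<in> I \<and> b then {rank I (length c)} else {})"
    by (auto simp: nths_append nth_append less_Suc_eq length_nths_rank)
  moreover have "{p. p < length (c @ [b]) \<and> p \<in> I \<and> (c @ [b]) ! p}
      = {p. p < length c \<and> p \<in> I \<and> c ! p} \<union> (if length c \<in> I \<and> b then {length c} else {})"
    by (auto simp: nth_append less_Suc_eq)
  ultimately show ?case using snoc unfolding set_ones by auto
qed (simp add: set_ones)

text \<open>If a whole cyclic stretch from \<open>p\<close> survives, each unit step in it remains a
  unit step after reindexing, now modulo the number of kept coordinates.\<close>

lemma rank_shift_mod:
  assumes "\<And>s. s \<le> m \<Longrightarrow> (p + s) mod L \<in> I" "p < L" "s \<le> m"
  shows "rank I ((p + s) mod L) = (rank I p + s) mod rank I L"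
  using assms(3)
proof (induction s)
  case 0
  then show ?case using assms(1)[of 0] assms(2) by (simp add: rank_less)
next
  case (Suc s)
  let ?q = "(p + s) mod L" and ?r = "(p + Suc s) mod L"
  have q: "?q \<in> I" "?q < L" using assms(1)[of s] assms(2) Suc.prems by auto
  have r: "?r \<in> I" "?r < L" using assms(1)[of "Suc s"] assms(2) Suc.prems by auto
  have *: "Suc (rank I ?q) mod rank I L = (rank I p + Suc s) mod rank I L"
    using Suc by (simp add: mod_Suc_eq)
  show ?case
  proof (cases "Suc ?q = L")
    \<comment> \<open>The old cycle wraps here. Its last coordinate is kept and gets the last new
      index, so the new cycle wraps as well.\<close>
    case True
    then have "?r = 0" by (simp add: mod_Suc)
    moreover have "Suc (rank I ?q) = rank I L" using q rank_Suc[of I ?q] True by simp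
    ultimately show ?thesis using * by simp
  next
    case False
    then have e: "?r = Suc ?q" by (simp add: mod_Suc)
    then have "rank I ?r = Suc (rank I ?q)" using q by (simp add: rank_Suc)
    moreover have "rank I ?r < rank I L" using r by (rule rank_less)
    ultimately show ?thesis using * by simp
  qed
qed

text \<open>The values \<open>a + S i\<close> increase and stay below \<open>2 * n\<close>, so
  reduction wraps at most once. Rotating the wrapped tail to the front yields a strictly increasing
  list, and such a list is determined by its set.\<close>

lemma sorted_list_eq_rotate:
  fixes S :: "nat \<Rightarrow> nat"
  assumes S: "strict_mono_on {..<l} S" "\<And>i. i < l \<Longrightarrow> S i < n"
    and "a < n"
    and xs: "sorted xs" "distinct xs" "set xs = (\<lambda>i. (a + S i) mod n) ` {..<l}"
  obtains k where "xs = rotate k (map (\<lambda>i. (a + S i) mod n) [0..<l])"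
proof -
  define R where "R = (\<lambda>i. (a + S i) mod n)"
  \<comment> \<open>By monotonicity the indices that do not wrap form an initial segment, so their
    number is the place of the wrap.\<close>
  define k where "k = card {i. i < l \<and> a + S i < n}"
  have mono: "S i < S j" if "i < j" "j < l" for i j
    using S(1) that by (auto simp: strict_mono_on_def)
  have k: "a + S i < n \<longleftrightarrow> i < k" if "i < l" for i
  proof
    assume "a + S i < n"
    have "{..i} \<subseteq> {i. i < l \<and> a + S i < n}"
    proof
      fix j assume "j \<in> {..i}"
      then have "j \<le> i" by simp
      then have "S j \<le> S i" using mono[of j i] that by (cases "j = i") auto
      then show "j \<in> {i. i < l \<and> a + S i < n}" using that \<open>a + S i < n\<close> \<open>j \<le> i\<close> by auto
    qed
    then have "card {..i} \<le> k" unfolding k_def by (intro card_mono) auto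
    then show "i < k" by simp
  next
    assume "i < k"
    show "a + S i < n"
    proof (rule ccontr)
      assume "\<not> a + S i < n"
      have "{i. i < l \<and> a + S i < n} \<subseteq> {..<i}"
      proof
        fix j assume j: "j \<in> {i. i < l \<and> a + S i < n}"
        show "j \<in> {..<i}"
        proof (rule ccontr)
          assume "j \<notin> {..<i}"
          then have "S i \<le> S j" using mono[of i j] j by (cases "i = j") auto
          then show False using j \<open>\<not> a + S i < n\<close> by simp
        qed
      qed
      then have "k \<le> card {..<i}" unfolding k_def by (intro card_mono) auto
      then show False using \<open>i < k\<close> by simp
    qed
  qed
  have kl: "k \<le> l"
    using card_mono[of "{..<l}" "{i. i < l \<and> a + S i < n}"] by (auto simp: k_def)
  have R: "R i = (if i < k then a + S i else a + S i - n)" if "i < l" for i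
    using k[OF that] S(2)[OF that] \<open>a < n\<close> that by (auto simp: R_def mod_if)
  have upt: "[0..<l] = [0..<k] @ [k..<l]"
    using kl upt_add_eq_append[of 0 k "l - k"] by simp
  have rot: "rotate k (map R [0..<l]) = map R [k..<l] @ map R [0..<k]"
    using rotate_append[of "map R [0..<k]" "map R [k..<l]"] unfolding upt map_append by simp
  have lt: "R i < R j" if "i < j" "j < l" "i \<ge> k \<or> j < k" for i j
    using that R[of i] R[of j] mono[of i j] k[of i] k[of j] by auto
  \<comment> \<open>Wrapped values lie below \<open>a\<close>, because \<open>S i < n\<close>; the
    others are at least \<open>a\<close>.\<close>
  have lt': "R i < R j" if "j < k" "k \<le> i" "i < l" for i j
    using that R[of i] R[of j] S(2)[of i] k[of i] by auto
  have "sorted_wrt (<) (map R [k..<l] @ map R [0..<k])"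
    unfolding sorted_wrt_append sorted_wrt_map
    by (auto simp: sorted_wrt_iff_nth_less intro: lt lt' dest: less_le_trans[OF _ kl])
  then have "sorted (rotate k (map R [0..<l]))" "distinct (rotate k (map R [0..<l]))"
    unfolding rot strict_sorted_iff by auto
  moreover have "set (rotate k (map R [0..<l])) = set xs"
    using xs(3) by (auto simp: R_def)
  ultimately have "xs = rotate k (map R [0..<l])"
    using xs by (intro sorted_distinct_set_unique) auto
  then show ?thesis unfolding R_def by (rule that)
qed

lemma mod_shift_inj:
  fixes p a b L :: nat
  assumes "(p + a) mod L = (p + b) mod L" "a < L" "b < L"
  shows "a = b"
  using assms
proof (induction a b rule: linorder_wlog)
  case (le a b)
  have "L dvd (p + b) - (p + a)"
    using le mod_eq_dvd_iff_nat[of "p + a" "p + b" L] by simp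
  then have "L dvd b - a" by simp
  then show ?case using le by (auto dest: dvd_imp_le)
qed (simp add: eq_commute)

lemma sum_list_rotate: "sum_list (rotate k xs) = sum_list xs"
  for xs :: "'b::comm_monoid_add list"
proof -
  have "sum_list (rotate1 ys) = sum_list ys" for ys :: "'b list"
    by (cases ys) (simp_all add: add.commute)
  then show ?thesis by (induction k) simp_all
qed

section \<open>The walk of the encoder around the cycle\<close>

locale encoding =
  fixes l t :: nat and x :: "bool list"
  assumes l_ge_3: "l \<ge> 3" and t_pos: "t > 0" and t_less: "t < f_seq l 1"
    and length_x: "length x = k_sum l - 2 * t"
begin

abbreviation n :: nat where "n \<equiv> code_len l t"

text \<open>Indexed in the order of processing: \<open>d 0\<close> fixes the start, and
  \<open>d i\<close> is the number of positions skipped in step \<open>i\<close>.\<close>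

definition d :: "nat \<Rightarrow> nat" where "d i = dec (block l t x (l - i))"

text \<open>The displacement from the start after \<open>m\<close> steps, not reduced modulo
  \<open>2 ^ l\<close>.\<close>

definition S :: "nat \<Rightarrow> nat" where "S m = (\<Sum>i = 1..m. 1 + d i)"

definition start :: nat where "start = 2 ^ t * d 0"

lemma f_seq_1_le: "f_seq l 1 \<le> l"
  using l_ge_3 by (auto simp: f_seq_def Let_def)

lemma sum_block_len: "(\<Sum>i = 1..l. block_len l t i) = length x"
proof -
  have split: "{1..l} = insert 1 (insert l {2..<l})" using l_ge_3 by auto
  have "(\<Sum>i = 1..l. g i) = g 1 + (g l + (\<Sum>i = 2..<l. g i))" for g :: "nat \<Rightarrow> nat"
    unfolding split using l_ge_3 by (subst sum.insert; simp)
  note this[of "block_len l t"] this[of "f_seq l"]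
  moreover have "(\<Sum>i = 2..<l. block_len l t i) = (\<Sum>i = 2..<l. f_seq l i)"
    by (rule sum.cong) (auto simp: block_len_def)
  moreover have "f_seq l l = l" by (simp add: f_seq_def)
  moreover have "block_len l t 1 = f_seq l 1 - t" "block_len l t l = l - t"
    using l_ge_3 by (simp_all add: block_len_def)
  ultimately show ?thesis
    using length_x t_less f_seq_1_le unfolding k_sum_def by linarith
qed

lemma length_block:
  assumes "1 \<le> i" "i \<le> l"
  shows "length (block l t x i) = block_len l t i"
proof -
  have "(\<Sum>k\<in>{i<..l}. block_len l t k) + block_len l t i = (\<Sum>k\<in>insert i {i<..l}. block_len l t k)"
    by simp
  also have "\<dots> \<le> (\<Sum>k = 1..l. block_len l t k)"
    using assms by (intro sum_mono2) auto
  finally have "(\<Sum>k\<in>{i<..l}. block_len l t k) + block_len l t i \<le> length x"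
    by (simp only: sum_block_len)
  then show ?thesis by (simp add: block_def)
qed

lemma concat_blocks: "concat (map (\<lambda>i. block l t x (l - i)) [0..<l]) = x"
proof -
  \<comment> \<open>Generalised for the induction: the first \<open>m\<close> blocks form a prefix
    of \<open>x\<close>.\<close>
  have "concat (map (\<lambda>i. block l t x (l - i)) [0..<m])
      = take (\<Sum>k\<in>{l - m<..l}. block_len l t k) x" if "m \<le> l" for m
    using that
  proof (induction m)
    case (Suc m)
    have "{l - Suc m<..l} = insert (l - m) {l - m<..l}" using Suc.prems by auto
    then have "(\<Sum>k\<in>{l - Suc m<..l}. block_len l t k)
        = (\<Sum>k\<in>{l - m<..l}. block_len l t k) + block_len l t (l - m)" by simp
    then show ?case using Suc by (simp add: block_def take_add)
  qed simp
  from this[of l] show ?thesis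
    by (simp add: sum_block_len[symmetric] atLeastSucAtMost_greaterThanAtMost)
qed

lemma start_less: "start < 2 ^ l"
proof -
  have "d 0 < 2 ^ (l - t)"
    using dec_less[of "block l t x l"] length_block[of l] l_ge_3 by (simp add: d_def block_len_def)
  then have "start < 2 ^ t * 2 ^ (l - t)" by (simp add: start_def)
  then show ?thesis using t_less f_seq_1_le by (simp flip: power_add)
qed

lemma d_less:
  assumes "1 \<le> i" "i < l"
  shows "d i < 2 * 2 ^ f_seq l 1"
proof -
  have "d i < 2 ^ block_len l t (l - i)"
    using dec_less[of "block l t x (l - i)"] length_block[of "l - i"] assms by (simp add: d_def)
  also have "(2::nat) ^ block_len l t (l - i) \<le> 2 ^ (f_seq l 1 + 1)"
    using f_seq_le_Suc[of l "l - i"] l_ge_3 assms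
    by (intro power_increasing) (auto simp: block_len_def)
  finally show ?thesis by simp
qed

lemma S_0 [simp]: "S 0 = 0" by (simp add: S_def)

lemma S_Suc [simp]: "S (Suc m) = S m + 1 + d (Suc m)" by (simp add: S_def)

lemma S_less: "i < j \<Longrightarrow> S i < S j"
  using strict_mono_Suc_iff[of S] by (simp add: strict_mono_def)

lemma S_le_last:
  assumes "i < l"
  shows "S i \<le> S (l - 1)"
proof (cases "i = l - 1")
  case False
  then have "i < l - 1" using assms by linarith
  then show ?thesis using S_less less_imp_le by blast
qed simp

text \<open>Shortening the last block by \<open>t\<close> bits frees room for the
  \<open>2 ^ t\<close>; the surplus of the exponents supplies the other term. The first makes room
  for the deleted stretch, the second makes the closing gap the largest.\<close>

lemma S_bound: "S (l - 1) + 2 ^ t + 2 * 2 ^ f_seq l 1 \<le> 2 ^ l"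
proof -
  define F where "F = f_seq l 1"
  define T :: nat where "T = (\<Sum>j = 2..<l. 2 ^ f_seq l j)"
  have split: "(\<Sum>j = 1..<l. g j) = g 1 + (\<Sum>j = 2..<l. g j)" for g :: "nat \<Rightarrow> nat"
    using l_ge_3 by (subst sum.atLeast_Suc_lessThan) (auto simp: numeral_2_eq_2)
  have "S (l - 1) = (\<Sum>j = 1..<l. 1 + dec (block l t x j))"
    unfolding S_def d_def using l_ge_3
    by (intro sum.reindex_bij_witness[of _ "\<lambda>j. l - j" "\<lambda>j. l - j"]) auto
  also have "\<dots> \<le> (\<Sum>j = 1..<l. 2 ^ block_len l t j)"
  proof (rule sum_mono)
    fix j assume "j \<in> {1..<l}"
    then show "1 + dec (block l t x j) \<le> 2 ^ block_len l t j"
      using dec_less[of "block l t x j"] length_block[of j] by simp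
  qed
  also have "\<dots> = 2 ^ block_len l t 1 + (\<Sum>j = 2..<l. 2 ^ block_len l t j)" by (rule split)
  also have "(\<Sum>j = 2..<l. 2 ^ block_len l t j) = T"
    unfolding T_def by (rule sum.cong) (auto simp: block_len_def)
  also have "block_len l t 1 = F - t" using l_ge_3 by (simp add: block_len_def F_def)
  finally have "S (l - 1) \<le> 2 ^ (F - t) + T" .
  moreover have "2 ^ F + T + 2 * 2 ^ F \<le> 2 ^ l"
    using sum_power_f_seq_le[of l] split[of "\<lambda>j. 2 ^ f_seq l j"] l_ge_3 t_less
    by (simp add: T_def F_def)
  \<comment> \<open>Since \<open>0 < t < F\<close>, both exponents are at most
    \<open>F - 1\<close>.\<close>
  moreover have "2 ^ (F - t) + 2 ^ t \<le> (2::nat) ^ F"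
  proof -
    have "2 ^ (F - t) \<le> (2::nat) ^ (F - 1)" "2 ^ t \<le> (2::nat) ^ (F - 1)"
      using t_pos t_less by (auto simp: F_def intro!: power_increasing)
    moreover have "(2::nat) ^ F = 2 * 2 ^ (F - 1)"
      using t_less by (cases F) (auto simp: F_def)
    ultimately show ?thesis by linarith
  qed
  ultimately show ?thesis unfolding F_def by linarith
qed

text \<open>Loop invariant after the first \<open>m\<close> passes, which treat the indices from
  \<open>l - 1\<close> down to \<open>l - m\<close>.\<close>

lemma fold_encode_step:
  assumes "m < l"
  shows "fold (encode_step l t x) (rev [l - m..<l]) ((replicate (2 ^ l) False)[start := True], start)
    = (map (\<lambda>p. \<exists>i\<le>m. p = (start + S i) mod 2 ^ l) [0..<2 ^ l], (start + S m) mod 2 ^ l)"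
  using assms
proof (induction m)
  case 0
  then show ?case using start_less by (auto intro!: nth_equalityI simp: nth_list_update split: if_splits)
next
  case (Suc m)
  have "[l - Suc m..<l] = (l - Suc m) # [l - m..<l]"
    using Suc.prems by (subst upt_conv_Cons) (auto simp: Suc_diff_Suc)
  moreover have "((start + S m) mod 2 ^ l + 1 + d (Suc m)) mod 2 ^ l = (start + S (Suc m)) mod 2 ^ l"
    using mod_add_left_eq[of "start + S m" "2 ^ l" "1 + d (Suc m)"] by (simp add: add.assoc)
  moreover have "(map (\<lambda>p. \<exists>i\<le>m. p = (start + S i) mod 2 ^ l) [0..<2 ^ l])[(start + S (Suc m)) mod 2 ^ l := True]
      = map (\<lambda>p. \<exists>i\<le>Suc m. p = (start + S i) mod 2 ^ l) [0..<2 ^ l]"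
    by (rule nth_equalityI) (auto simp: nth_list_update le_Suc_eq simp del: S_Suc)
  ultimately show ?case
    using Suc by (simp add: encode_step_def Let_def del: S_Suc flip: d_def)
qed

section \<open>The effect of the deletion on the ones\<close>

definition removed :: "nat set" where
  "removed = {(start + S (l - 1) + e) mod 2 ^ l | e. 1 \<le> e \<and> e \<le> 2 ^ t - 1}"

lemma EncodeB_eq:
  "EncodeB l t x = nths (map (\<lambda>p. \<exists>i<l. p = (start + S i) mod 2 ^ l) [0..<2 ^ l]) (- removed)"
proof -
  have "[1..<l] = [l - (l - 1)..<l]" using l_ge_3 by simp
  moreover have "2 ^ t * dec (block l t x l) = start" by (simp add: start_def d_def)
  moreover have "i \<le> l - 1 \<longleftrightarrow> i < l" for i using l_ge_3 by auto
  moreover have "l - 1 < l" using l_ge_3 by simp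
  ultimately show ?thesis
    by (simp only: EncodeB_def Let_def fold_encode_step removed_def mod_add_left_eq split)
qed

text \<open>Walk and deleted stretch together make less than one lap. All positions passed over are
  covered, not only the ones, as \<open>rank_shift_mod\<close> requires.\<close>

lemma shift_not_removed:
  assumes "s \<le> S (l - 1)"
  shows "(start + s) mod 2 ^ l \<in> - removed"
proof
  assume "(start + s) mod 2 ^ l \<in> removed"
  then obtain e where e: "1 \<le> e" "e \<le> 2 ^ t - 1"
    and eq: "(start + s) mod 2 ^ l = (start + (S (l - 1) + e)) mod 2 ^ l"
    by (auto simp: removed_def add.assoc)
  have "s < 2 ^ l" "S (l - 1) + e < 2 ^ l"
    using assms e S_bound by (auto simp: le_diff_conv2 algebra_simps)
  from mod_shift_inj[OF eq this] show False using assms e by simp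
qed

lemma removed_eq: "removed = (\<lambda>e. (start + S (l - 1) + e) mod 2 ^ l) ` {1..2 ^ t - 1}"
  by (auto simp: removed_def)

lemma finite_removed: "finite removed"
  by (simp add: removed_eq)

lemma card_removed: "card removed = 2 ^ t - 1"
proof -
  have "(2::nat) ^ t < 2 ^ l"
  proof -
    have "(0::nat) < 2 ^ f_seq l 1" by simp
    then show ?thesis using S_bound by linarith
  qed
  then have "inj_on (\<lambda>e. (start + S (l - 1) + e) mod 2 ^ l) {1..2 ^ t - 1}"
  proof (intro inj_onI)
    fix e e' :: nat assume "e \<in> {1..2 ^ t - 1}" "e' \<in> {1..2 ^ t - 1}"
    then have "e < 2 ^ l" "e' < 2 ^ l" using \<open>(2::nat) ^ t < 2 ^ l\<close> unfolding atLeastAtMost_iff by linarith+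
    then show "e = e'"
      if "(start + S (l - 1) + e) mod 2 ^ l = (start + S (l - 1) + e') mod 2 ^ l"
      using mod_shift_inj[OF that] by blast
  qed
  then show ?thesis by (simp add: removed_eq card_image)
qed

lemma rank_removed: "rank (- removed) p + card {q \<in> removed. q < p} = p"
proof -
  have "rank (- removed) p + card {q \<in> removed. q < p} = card ({q. q < p \<and> q \<in> - removed} \<union> {q \<in> removed. q < p})"
    unfolding rank_def by (rule card_Un_disjoint[symmetric]) auto
  also have "{q. q < p \<and> q \<in> - removed} \<union> {q \<in> removed. q < p} = {..<p}" by auto
  finally show ?thesis by simp
qed

lemma rank_full: "rank (- removed) (2 ^ l) = n"
proof -
  have "{q \<in> removed. q < 2 ^ l} = removed" by (auto simp: removed_def)
  then have "rank (- removed) (2 ^ l) + (2 ^ t - 1) = 2 ^ l"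
    using rank_removed[of "2 ^ l"] by (simp add: card_removed)
  moreover have "(1::nat) \<le> 2 ^ t" "(2::nat) ^ t \<le> 2 ^ l" using S_bound by (simp, linarith)
  ultimately show ?thesis unfolding code_len_def by linarith
qed

text \<open>The index of the starting one in the output.\<close>

definition a :: nat where "a = rank (- removed) start"

lemma a_less: "a < n"
  using shift_not_removed[of 0] start_less rank_less[of start "- removed" "2 ^ l"]
  by (simp add: a_def rank_full)

text \<open>At most \<open>2 ^ t - 1\<close> deleted coordinates lie below \<open>start\<close>, so
  \<open>a\<close> falls short of \<open>2 ^ t * d 0\<close> by less than
  \<open>2 ^ t\<close>.\<close>

lemma ceiling_a: "\<lceil>real a / 2 ^ t\<rceil> = int (d 0)"
proof -
  have c: "card {q \<in> removed. q < start} \<le> 2 ^ t - 1"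
    unfolding card_removed[symmetric] by (rule card_mono) (auto simp: finite_removed)
  have eq: "a + card {q \<in> removed. q < start} = 2 ^ t * d 0"
    using rank_removed[of start] by (simp add: a_def start_def)
  have "a \<le> 2 ^ t * d 0" "2 ^ t * d 0 < a + 2 ^ t"
  proof -
    show "a \<le> 2 ^ t * d 0" using eq by linarith
    have "(1::nat) \<le> 2 ^ t" by simp
    then show "2 ^ t * d 0 < a + 2 ^ t" using eq c by linarith
  qed
  then have "real a \<le> real (2 ^ t * d 0)" "real (2 ^ t * d 0) < real (a + 2 ^ t)"
    by (simp_all only: of_nat_le_iff of_nat_less_iff)
  then show ?thesis by (intro ceiling_unique) (simp_all add: field_simps)
qed

lemma S_less_n: "i < l \<Longrightarrow> S i < n"
  using S_le_last[of i] S_bound unfolding code_len_def by linarith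

lemma ones_EncodeB:
  obtains k where "ones (EncodeB l t x) = rotate k (map (\<lambda>i. (a + S i) mod n) [0..<l])"
proof -
  let ?c = "map (\<lambda>p. \<exists>i<l. p = (start + S i) mod 2 ^ l) [0..<2 ^ l]"
  have r: "rank (- removed) ((start + S i) mod 2 ^ l) = (a + S i) mod n" if "i < l" for i
    using rank_shift_mod[of "S (l - 1)" start "2 ^ l" "- removed" "S i"]
      shift_not_removed start_less S_le_last[OF that] by (simp add: a_def rank_full del: One_nat_def)
  have "(start + S i) mod 2 ^ l \<in> - removed" if "i < l" for i
    using that by (intro shift_not_removed S_le_last)
  then have "{p. p < length ?c \<and> p \<in> - removed \<and> ?c ! p} = (\<lambda>i. (start + S i) mod 2 ^ l) ` {..<l}"
    by auto
  then have "set (ones (EncodeB l t x)) = (\<lambda>i. (a + S i) mod n) ` {..<l}"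
    unfolding EncodeB_eq set_ones_nths by (simp add: image_image r cong: image_cong_simp)
  moreover have "strict_mono_on {..<l} S" by (auto simp: strict_mono_on_def S_less)
  ultimately show ?thesis
    using sorted_list_eq_rotate[of l S n a "ones (EncodeB l t x)"] S_less_n a_less that
    by (auto simp: ones_def sorted_wrt_filter)
qed

section \<open>Gaps between cyclically consecutive ones\<close>

text \<open>The gaps in visiting order; index 0 is the gap from the last visited one back to the
  start.\<close>

definition gap :: "nat \<Rightarrow> int" where
  "gap i = (if i = 0 then int n - 1 - int (S (l - 1)) else int (d i))"

text \<open>The offset \<open>a\<close> cancels modulo \<open>n\<close>, and what remains already
  lies between 0 and \<open>n - 1\<close>. The index \<open>(i + l - 1) mod l\<close> is the cyclic
  predecessor of \<open>i\<close>.\<close>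

lemma gap_mod:
  assumes "i < l"
  shows "(int ((a + S i) mod n) - int ((a + S ((i + l - 1) mod l)) mod n) - 1) mod int n = gap i"
proof -
  have n0: "S (l - 1) < n" using S_less_n[of "l - 1"] l_ge_3 by simp
  have "(int ((a + S i) mod n) - int ((a + S j) mod n) - 1) mod int n = (int (S i) - int (S j) - 1) mod int n" for j
  proof -
    have "(int ((a + S i) mod n) - int ((a + S j) mod n) - 1) mod int n
      = (int (a + S i) - int (a + S j) - 1) mod int n"
      unfolding zmod_int by (intro mod_diff_cong) simp_all
    then show ?thesis by simp
  qed
  note * = this
  show ?thesis
  proof (cases i)
    case 0
    have "(- int (S (l - 1)) - 1) mod int n = (int n + (- int (S (l - 1)) - 1)) mod int n" by simp
    also have "\<dots> = int n + (- int (S (l - 1)) - 1)" using n0 by (intro mod_pos_pos_trivial) auto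
    finally show ?thesis using 0 l_ge_3 unfolding * by (simp add: gap_def)
  next
    case (Suc j)
    then have "(i + l - 1) mod l = j" using assms by simp
    moreover have "d i < n" using S_less_n[of i] Suc assms by simp
    ultimately show ?thesis unfolding * using Suc by (simp add: gap_def)
  qed
qed

text \<open>Taking cyclic predecessors commutes with rotation.\<close>

lemma gaps_EncodeB:
  assumes ones: "ones (EncodeB l t x) = rotate k (map (\<lambda>i. (a + S i) mod n) [0..<l])"
  shows "gaps l t (EncodeB l t x) = rotate k (map gap [0..<l])"
proof (rule nth_equalityI)
  fix m assume "m < length (gaps l t (EncodeB l t x))"
  then have m: "m < l" by (simp add: gaps_def)
  have o: "ones (EncodeB l t x) ! j = (a + S ((k + j) mod l)) mod n" if "j < l" for j
    unfolding ones using that by (simp add: nth_rotate)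
  have "nat ((int m - 1) mod int l) = (m + l - 1) mod l"
  proof -
    have "(int m - 1) mod int l = (int m - 1 + int l) mod int l" by simp
    also have "int m - 1 + int l = int (m + l - 1)" using l_ge_3 by simp
    finally show ?thesis by (simp flip: zmod_int)
  qed
  then have "gaps l t (EncodeB l t x) ! m
      = (int ((a + S ((k + m) mod l)) mod n) - int ((a + S ((k + (m + l - 1) mod l) mod l)) mod n) - 1) mod int n"
    using m by (simp add: gaps_def o)
  also have "(k + (m + l - 1) mod l) mod l = ((k + m) mod l + l - 1) mod l"
  proof -
    have "m + l - 1 = m + (l - 1)" "(k + m) mod l + l - 1 = (k + m) mod l + (l - 1)"
      using l_ge_3 by simp_all
    then show ?thesis by (simp only: mod_add_left_eq mod_add_right_eq add.assoc)
  qed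
  also have "(int ((a + S ((k + m) mod l)) mod n) - int ((a + S (((k + m) mod l + l - 1) mod l)) mod n) - 1) mod int n
      = gap ((k + m) mod l)" using m by (intro gap_mod) simp
  finally show "gaps l t (EncodeB l t x) ! m = rotate k (map gap [0..<l]) ! m"
    using m by (simp add: nth_rotate)
qed (simp add: gaps_def)

section \<open>Locating the start of the walk\<close>

lemma sum_gap: "sum_list (map gap [0..<l]) = int n - int l"
proof -
  have "sum_list (map gap [0..<Suc m]) = int n - 1 - int (S (l - 1)) + int (S m) - int m" for m
    by (induction m) (simp_all add: gap_def)
  from this[of "l - 1"] show ?thesis using l_ge_3 by simp
qed

text \<open>The first entry is built so that all powers from the other entries cancel.\<close>

lemma sum_gamma_B: "sum_list (gamma_B l t) = 2 ^ l - int l"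
proof -
  have "sum_list (map (\<lambda>i. 2 ^ f_seq l i - 1 :: int) (rev [2..<l])) = (\<Sum>i = 2..<l. 2 ^ f_seq l i - 1)"
    by (simp add: interv_sum_list_conv_sum_set_nat flip: rev_map)
  also have "\<dots> = (\<Sum>i = 2..<l. 2 ^ f_seq l i) - (int l - 2)"
    using l_ge_3 by (simp add: sum_subtractf)
  moreover have "(\<Sum>i = 1..l - 1. 2 ^ f_seq l i) = 2 ^ f_seq l 1 + (\<Sum>i = 2..<l. 2 ^ f_seq l i :: int)"
  proof -
    have "{1..l - 1} = insert 1 {2..<l}" using l_ge_3 by auto
    then show ?thesis by simp
  qed
  ultimately show ?thesis by (simp add: gamma_B_def)
qed

text \<open>
  A codeword has \<open>2 ^ t - 1\<close> fewer zeros than \<open>gamma_B\<close> accounts for, so the first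
  branch of \<open>anchor\<close> is never taken.
\<close>

lemma anchor_eq:
  "anchor l t (rotate k (map gap [0..<l])) < l
    \<and> (k + anchor l t (rotate k (map gap [0..<l]))) mod l = 0"
proof -
  let ?g = "rotate k (map gap [0..<l])"
  have "rotate n0 ?g \<noteq> gamma_B l t" for n0
  proof
    assume "rotate n0 ?g = gamma_B l t"
    then have "int n - int l = 2 ^ l - int l"
      by (metis sum_gamma_B sum_gap sum_list_rotate)
    then have "int n = int (2 ^ l)" by simp
    then have "n = 2 ^ l" by (simp only: of_nat_eq_iff)
    moreover have "(2::nat) ^ t \<le> 2 ^ l" using S_bound by linarith
    moreover have "(2::nat) \<le> 2 ^ t" using t_pos by (cases t) auto
    ultimately show False unfolding code_len_def by linarith
  qed
  then have A: "anchor l t ?g = (ARG_MAX (\<lambda>m. ?g ! m) m. m < l)" by (auto simp: anchor_def)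
  have g: "?g ! m = gap ((k + m) mod l)" if "m < l" for m using that by (simp add: nth_rotate)
  have big: "gap i < gap 0" if "0 < i" "i < l" for i
  proof -
    have "d i < 2 * 2 ^ f_seq l 1" using that by (intro d_less) auto
    then have "d i + 1 + S (l - 1) < n" using S_bound unfolding code_len_def by linarith
    then show ?thesis using that by (simp add: gap_def)
  qed
  \<comment> \<open>This is \<open>-k\<close> modulo \<open>l\<close>, the place to which the
    rotation moves gap 0.\<close>
  define m0 where "m0 = (l - k mod l) mod l"
  have m0: "m0 < l" "(k + m0) mod l = 0"
  proof -
    show "m0 < l" using l_ge_3 by (simp add: m0_def)
    have "(k + m0) mod l = (k mod l + (l - k mod l)) mod l" unfolding m0_def by (simp add: mod_simps)
    also have "k mod l + (l - k mod l) = l" using l_ge_3 by simp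
    finally show "(k + m0) mod l = 0" by simp
  qed
  have "is_arg_max (\<lambda>m. ?g ! m) (\<lambda>m. m < l) m0"
  proof -
    have "gap ((k + y) mod l) \<le> gap 0" if "y < l" for y
      using big[of "(k + y) mod l"] that by (cases "(k + y) mod l = 0") auto
    then have "?g ! y \<le> ?g ! m0" if "y < l" for y using that m0 by (simp only: g)
    then show ?thesis unfolding is_arg_max_linorder using m0(1) by blast
  qed
  then have max: "is_arg_max (\<lambda>m. ?g ! m) (\<lambda>m. m < l) (anchor l t ?g)"
    unfolding A arg_max_def by (rule someI)
  define A where "A = anchor l t ?g"
  have "A < l" "\<not> ?g ! m0 > ?g ! A" using max m0 by (auto simp: is_arg_max_def A_def)
  moreover have "(k + A) mod l < l" using l_ge_3 by simp
  \<comment> \<open>Gap 0 is strictly the largest, so the choice made by \<open>ARG_MAX\<close> is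
    forced.\<close>
  ultimately have "(k + A) mod l = 0" using big[of "(k + A) mod l"] g m0 by auto
  with \<open>A < l\<close> show ?thesis by (simp add: A_def)
qed

text \<open>The anchor undoes the unknown rotation by \<open>k\<close>: read from it, the gaps
  appear in visiting order and return the blocks one by one.\<close>

lemma DecodeB_EncodeB: "DecodeB l t (EncodeB l t x) = x"
proof -
  obtain k where ones: "ones (EncodeB l t x) = rotate k (map (\<lambda>i. (a + S i) mod n) [0..<l])"
    using ones_EncodeB by blast
  define A where "A = anchor l t (rotate k (map gap [0..<l]))"
  have A: "A < l" "(k + A) mod l = 0" using anchor_eq by (auto simp: A_def)
  \<comment> \<open>Entry \<open>A\<close> of the rotated list is entry 0 of the visiting order, and
    \<open>S 0 = 0\<close>.\<close>
  have "ones (EncodeB l t x) ! A = a" unfolding ones using A a_less by (simp add: nth_rotate)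
  then have first: "bin_rep (l - t) (nat \<lceil>real (ones (EncodeB l t x) ! A) / 2 ^ t\<rceil>) = block l t x l"
    using length_block[of l] l_ge_3 by (simp add: ceiling_a d_def block_len_def bin_rep_dec)
  have rest: "bin_rep (if i \<le> l - 2 then f_seq l (l - i) else f_seq l 1 - t)
      (nat (rotate k (map gap [0..<l]) ! ((A + i) mod l))) = block l t x (l - i)"
    if "1 \<le> i" "i < l" for i
  proof -
    have "(k + (A + i) mod l) mod l = ((k + A) mod l + i) mod l"
      by (simp add: mod_simps add.assoc)
    then have "rotate k (map gap [0..<l]) ! ((A + i) mod l) = gap i"
      using that A by (simp add: nth_rotate)
    moreover have "(if i \<le> l - 2 then f_seq l (l - i) else f_seq l 1 - t) = block_len l t (l - i)"
      using that by (auto simp: block_len_def)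
    ultimately show ?thesis
      using that length_block[of "l - i"] by (simp add: gap_def d_def bin_rep_dec)
  qed
  have "DecodeB l t (EncodeB l t x) = block l t x l @ concat (map (\<lambda>i. block l t x (l - i)) [1..<l])"
    unfolding DecodeB_def Let_def gaps_EncodeB[OF ones] A_def[symmetric] first
    using rest by (auto intro!: arg_cong[of _ _ concat])
  also have "\<dots> = concat (map (\<lambda>i. block l t x (l - i)) [0..<l])"
    using l_ge_3 by (simp add: upt_conv_Cons)
  finally show ?thesis by (simp only: concat_blocks)
qed

end

theorem lemma5p2:
  fixes l t :: nat and x :: "bool list"
  assumes "l \<ge> 3" and "t > 0" and "t < f_seq l 1"
    and "length x = k_sum l - 2 * t"
  shows "DecodeB l t (EncodeB l t x) = x"
proof -
  interpret encoding l t x using assms by unfold_locales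
  show ?thesis by (rule DecodeB_EncodeB)
qed

end
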